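(* Let $\mathcal{S}$ be a finite generalized quadrangle of order $(s,t)$ and $\mathcal{S}'$ a proper subquadrangle of $\mathcal{S}$ of order $(s,t')$, with $s\ne 1$. If every subtended ovoid $\mathcal{O}_x$ of $\mathcal{S}'$ is $\theta$-subtended, $\theta>1$, with $t'\ne 1$, $t=st'$, and $(\theta-1)t=s^2$, then the geometry $\mathcal{E}=(\Omega,\Phi,\in)$ is a semipartial geometry with parameters $$s^*=s-1,\quad t^*=t,\quad \alpha^*=\theta,\quad \mu^*=\theta(t-t').$$
   Context: A generalized quadrangle (GQ) of order $(s,t)$ is a point-line incidence geometry in which each point is incident with $t+1$ lines, each line with $s+1$ points, two distinct points are incident with at most one line, and for each non-incident point-line pair $(x,L)$ there is exactly one point-line pair $(y,M)$ with $x\,\mathbf{I}\,M\,\mathbf{I}\,y\,\mathbf{I}\,L$. For a point $x$, $x^\perp$ is the set of points collinear with $x$ (including $x$). For a point $x$ of $\mathcal{S}$ not in $\mathcal{S}'$, the set $\mathcal{O}_x$ of points of $\mathcal{S}'$ collinear with $x$ is (here) an ovoid of $\mathcal{S}'$ (a point set meeting each line of $\mathcal{S}'$ in exactly one point), said to be subtended by $x$. The ovoid $\mathcal{O}_x$ is $\theta$-subtended if exactly $\theta$ points of $\mathcal{S}\setminus\mathcal{S}'$ subtend it. For a line $L$ of $\mathcal{S}$ not in $\mathcal{S}'$ having a point $z$ in common with $\mathcal{S}'$, the rosette $R_L$ is the set of the $s$ ovoids $\mathcal{O}_x$ with $x$ on $L$, $x\neq z$. $\Omega$ is the set of all subtended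 ovoids of $\mathcal{S}'$ and $\Phi$ is the set of all rosettes $R_L$; $\mathcal{E}=(\Omega,\Phi,\in)$ has point set $\Omega$, line set $\Phi$ and incidence containment. A semipartial geometry with parameters $s^*,t^*,\alpha^*,\mu^*$ is a point-line geometry in which each line has $s^*+1$ points, each point is on $t^*+1$ lines, two distinct points are on at most one common line, for each non-incident point-line pair $(x,L)$ the number of points of $L$ collinear with $x$ is $0$ or $\alpha^*$ ($\alpha^*>0$), and for any two non-collinear points there are exactly $\mu^*$ points ($\mu^*>0$) collinear with both. *)

theory Defs
  imports Main
begin

text \<open>Only the restriction of \<open>inc\<close> to \<open>points \<times> lines\<close> is meaningful. Lines are abstract objects,
  not necessarily sets of points.\<close>

record ('p, 'l) geometry =
  points :: "'p set"
  lines :: "'l set"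
  inc :: "'p \<Rightarrow> 'l \<Rightarrow> bool"

definition finite_geometry :: "('p, 'l) geometry \<Rightarrow> bool" where
  "finite_geometry S \<longleftrightarrow> finite (points S) \<and> finite (lines S)"

text \<open>The part common to generalized quadrangles and semipartial geometries. As usual, point set
  and line set are nonempty. The cardinalities \<open>s + 1\<close> and \<open>t + 1\<close> are positive, so that the
  convention \<open>card A = 0\<close> for infinite \<open>A\<close> does no harm.\<close>

definition partial_linear_space :: "('p, 'l) geometry \<Rightarrow> nat \<Rightarrow> nat \<Rightarrow> bool" where
  "partial_linear_space S s t \<longleftrightarrow>
     points S \<noteq> {} \<and> lines S \<noteq> {} \<and>
     (\<forall>L\<in>lines S. card {x \<in> points S. inc S x L} = s + 1) \<and>
     (\<forall>x\<in>points S. card {L \<in> lines S. inc S x L} = t + 1) \<and>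
     (\<forall>x\<in>points S. \<forall>y\<in>points S. \<forall>L\<in>lines S. \<forall>M\<in>lines S.
        x \<noteq> y \<and> inc S x L \<and> inc S y L \<and> inc S x M \<and> inc S y M \<longrightarrow> L = M)"

definition collinear :: "('p, 'l) geometry \<Rightarrow> 'p \<Rightarrow> 'p \<Rightarrow> bool" where
  "collinear S x y \<longleftrightarrow> x = y \<or> (\<exists>L\<in>lines S. inc S x L \<and> inc S y L)"

definition perp :: "('p, 'l) geometry \<Rightarrow> 'p \<Rightarrow> 'p set" where
  "perp S x = {y \<in> points S. collinear S x y}"

definition generalized_quadrangle :: "('p, 'l) geometry \<Rightarrow> nat \<Rightarrow> nat \<Rightarrow> bool" where
  "generalized_quadrangle S s t \<longleftrightarrow>
     partial_linear_space S s t \<and>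
     (\<forall>x\<in>points S. \<forall>L\<in>lines S. \<not> inc S x L \<longrightarrow>
        (\<exists>!(y, M). y \<in> points S \<and> M \<in> lines S \<and> inc S x M \<and> inc S y M \<and> inc S y L))"

definition semipartial_geometry ::
  "('p, 'l) geometry \<Rightarrow> nat \<Rightarrow> nat \<Rightarrow> nat \<Rightarrow> nat \<Rightarrow> bool" where
  "semipartial_geometry S s t \<alpha> \<mu> \<longleftrightarrow>
     partial_linear_space S s t \<and> \<alpha> > 0 \<and> \<mu> > 0 \<and>
     (\<forall>x\<in>points S. \<forall>L\<in>lines S. \<not> inc S x L \<longrightarrow>
        card {y \<in> points S. inc S y L \<and> collinear S x y} \<in> {0, \<alpha>}) \<and>
     (\<forall>x\<in>points S. \<forall>y\<in>points S. \<not> collinear S x y \<longrightarrow>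
        card (perp S x \<inter> perp S y) = \<mu>)"

text \<open>The incidence of the subgeometry is the restriction of that of the ambient geometry; the
  order of \<open>S'\<close> as a generalized quadrangle is specified separately.\<close>

definition subgeometry :: "('p, 'l) geometry \<Rightarrow> ('p, 'l) geometry \<Rightarrow> bool" where
  "subgeometry S' S \<longleftrightarrow>
     points S' \<subseteq> points S \<and> lines S' \<subseteq> lines S \<and>
     (\<forall>x\<in>points S'. \<forall>L\<in>lines S'. inc S' x L \<longleftrightarrow> inc S x L)"

definition proper_subquadrangle ::
  "('p, 'l) geometry \<Rightarrow> ('p, 'l) geometry \<Rightarrow> nat \<Rightarrow> nat \<Rightarrow> bool" where
  "proper_subquadrangle S' S s t' \<longleftrightarrow>
     subgeometry S' S \<and> generalized_quadrangle S' s t' \<and>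
     (points S' \<noteq> points S \<or> lines S' \<noteq> lines S)"

definition ovoid :: "('p, 'l) geometry \<Rightarrow> 'p set \<Rightarrow> bool" where
  "ovoid S A \<longleftrightarrow> A \<subseteq> points S \<and> (\<forall>L\<in>lines S. \<exists>!y. y \<in> A \<and> inc S y L)"

text \<open>\<open>\<O>\<^sub>x\<close>, for a point \<open>x\<close> of \<open>S\<close> not in \<open>S'\<close>; collinearity is that of \<open>S\<close>.\<close>

definition subtended :: "('p, 'l) geometry \<Rightarrow> ('p, 'l) geometry \<Rightarrow> 'p \<Rightarrow> 'p set" where
  "subtended S S' x = perp S x \<inter> points S'"

lemma ovoid_subtended:
  assumes S: "generalized_quadrangle S s t" and S': "proper_subquadrangle S' S s t'"
    and x: "x \<in> points S - points S'"
  shows "ovoid S' (subtended S S' x)"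
proof -
  have S'_order: "card {y \<in> points S'. inc S' y L} = s + 1" if "L \<in> lines S'" for L
    using S' that
    by (auto simp: proper_subquadrangle_def generalized_quadrangle_def partial_linear_space_def)
  have S_order: "card {y \<in> points S. inc S y L} = s + 1" if "L \<in> lines S" for L
    using S that by (auto simp: generalized_quadrangle_def partial_linear_space_def)
  have sub: "subgeometry S' S"
    using S' by (simp add: proper_subquadrangle_def)
  have "\<exists>!y. y \<in> subtended S S' x \<and> inc S' y L" if L: "L \<in> lines S'" for L
  proof -
    have L': "L \<in> lines S"
      using L sub by (auto simp: subgeometry_def)
    have "finite {y \<in> points S. inc S y L}"
      using S_order[OF L'] by (intro card_ge_0_finite) simp
    moreover have "{y \<in> points S'. inc S' y L} \<subseteq> {y \<in> points S. inc S y L}"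
      using L sub by (auto simp: subgeometry_def)
    ultimately have eq: "{y \<in> points S'. inc S' y L} = {y \<in> points S. inc S y L}"
      using S'_order[OF L] S_order[OF L'] by (intro card_subset_eq) auto
    have on_L: "y \<in> points S' \<and> inc S' y L \<longleftrightarrow> y \<in> points S \<and> inc S y L" for y
      using eq by (auto simp: set_eq_iff)
    have nL: "\<not> inc S x L"
      using on_L x by auto
    define P where
      "P = (\<lambda>(y, M). y \<in> points S \<and> M \<in> lines S \<and> inc S x M \<and> inc S y M \<and> inc S y L)"
    have "\<forall>x\<in>points S. \<forall>L\<in>lines S. \<not> inc S x L \<longrightarrow>
        (\<exists>!(y, M). y \<in> points S \<and> M \<in> lines S \<and> inc S x M \<and> inc S y M \<and> inc S y L)"
      using S unfolding generalized_quadrangle_def by (rule conjunct2)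
    then have "\<exists>!w. P w"
      unfolding P_def using x L' nL by (elim ballE impE) auto
    then obtain w where "P w" and w: "\<And>v. P v \<Longrightarrow> v = w"
      by (rule ex1E) blast
    obtain y M where [simp]: "w = (y, M)"
      by (cases w)
    have uniq': "(z, N) = (y, M)" if "P (z, N)" for z N
      using w[OF that] by simp
    have yM: "y \<in> points S" "M \<in> lines S" "inc S x M" "inc S y M" "inc S y L"
      using \<open>P w\<close> by (auto simp: P_def)
    have uniq: "z = y" if "z \<in> points S" "N \<in> lines S" "inc S x N" "inc S z N" "inc S z L"
      for z N
      using uniq'[of z N] that by (simp add: P_def)
    show ?thesis
    proof (intro ex1I[of _ y] conjI)
      show "y \<in> subtended S S' x" "inc S' y L"
        using yM on_L[of y] by (auto simp: subtended_def perp_def collinear_def)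
    next
      fix z assume z: "z \<in> subtended S S' x \<and> inc S' z L"
      then have "z \<in> points S" "inc S z L" "z \<noteq> x" "collinear S x z"
        using on_L[of z] x by (auto simp: subtended_def perp_def)
      then show "z = y"
        using uniq by (auto simp: collinear_def)
    qed
  qed
  then show ?thesis
    by (auto simp: ovoid_def subtended_def)
qed

definition theta_subtended ::
  "('p, 'l) geometry \<Rightarrow> ('p, 'l) geometry \<Rightarrow> nat \<Rightarrow> 'p set \<Rightarrow> bool" where
  "theta_subtended S S' \<theta> A \<longleftrightarrow>
     card {x \<in> points S - points S'. subtended S S' x = A} = \<theta>"

definition subtended_ovoids :: "('p, 'l) geometry \<Rightarrow> ('p, 'l) geometry \<Rightarrow> 'p set set" where
  "subtended_ovoids S S' = subtended S S' ` (points S - points S')"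

text \<open>\<open>R\<^sub>L\<close>, where \<open>z\<close> is the (unique) point of \<open>S'\<close> on the line \<open>L\<close> of \<open>S\<close>, \<open>L\<close> not in \<open>S'\<close>.\<close>

definition rosette :: "('p, 'l) geometry \<Rightarrow> ('p, 'l) geometry \<Rightarrow> 'l \<Rightarrow> 'p \<Rightarrow> 'p set set" where
  "rosette S S' L z = subtended S S' ` {x \<in> points S. inc S x L \<and> x \<noteq> z}"

definition rosettes :: "('p, 'l) geometry \<Rightarrow> ('p, 'l) geometry \<Rightarrow> 'p set set set" where
  "rosettes S S' =
     {rosette S S' L z | L z. L \<in> lines S - lines S' \<and> z \<in> points S' \<and> inc S z L}"

definition ovoid_rosette_geometry ::
  "('p, 'l) geometry \<Rightarrow> ('p, 'l) geometry \<Rightarrow> ('p set, 'p set set) geometry" where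
  "ovoid_rosette_geometry S S' =
     \<lparr>points = subtended_ovoids S S', lines = rosettes S S', inc = (\<in>)\<rparr>"

end

theory Submission imports Defs begin

text \<open>Write \<open>\<O> x\<close> for the ovoid subtended by an external point \<open>x\<close>, and call two external points
  twins if they subtend the same ovoid. Since \<open>t = s t'\<close>, an ovoid has \<open>t + 1\<close> points, so the trace
  of two twins is the ovoid itself and an external point is collinear with at most one twin of \<open>x\<close>.
  If \<open>y\<close> is collinear with a twin of \<open>x\<close>, then \<open>\<bar>\<O> x \<inter> \<O> y\<bar> = 1\<close>. Otherwise a variance count, in
  which \<open>(\<theta> - 1) t = s\<^sup>2\<close> is exactly what is needed, gives \<open>\<bar>\<O> x \<inter> \<O> y\<bar> = t' + 1\<close>. Hence being
  collinear with a twin of \<open>x\<close> depends only on the subtended ovoids, collinear twin classes are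
  perfectly matched by collinearity, and the rosettes of the \<open>\<theta>\<close> lines joining a point \<open>z\<close> of \<open>\<O> x\<close>
  to the twins of \<open>x\<close> coincide. All parameters can then be counted in \<open>S\<close>.\<close>

section \<open>Double counting, collinearity and a polynomial identity\<close>

lemma sum_multicount_eq:
  fixes m n :: nat
  assumes "finite A" "finite B"
    and "\<And>a. a \<in> A \<Longrightarrow> card {b \<in> B. R a b} = m"
    and "\<And>b. b \<in> B \<Longrightarrow> card {a \<in> A. R a b} = n"
  shows "card A * m = card B * n"
proof -
  have "(\<Sum>a\<in>A. card {b \<in> B. R a b}) = (\<Sum>b\<in>B. n)"
    using assms by (intro sum_multicount_gen) auto
  then show ?thesis
    using assms(3) by simp
qed

lemma card_eq_1I:
  assumes "a \<in> A" "\<And>b. b \<in> A \<Longrightarrow> b = a"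
  shows "card A = 1"
  using assms by (metis is_singletonI' is_singleton_altdef empty_iff)

lemma collinear_refl [simp]: "collinear S x x"
  by (simp add: collinear_def)

lemma collinear_commute: "collinear S x y \<longleftrightarrow> collinear S y x"
  by (auto simp: collinear_def)

lemma collinearI: "L \<in> lines S \<Longrightarrow> inc S x L \<Longrightarrow> inc S y L \<Longrightarrow> collinear S x y"
  by (auto simp: collinear_def)

lemma collinearE:
  assumes "collinear S x y" "x \<noteq> y"
  obtains L where "L \<in> lines S" "inc S x L" "inc S y L"
  using assms by (auto simp: collinear_def)

text \<open>The left side expands the sum of \<open>(|\<O> x \<inter> \<O> y| - (t' + 1))^2\<close>
  over all external \<open>y\<close> through its moments; the right side is the share of the twins
  of \<open>x\<close> and of the points tied to \<open>x\<close>. Substituting \<open>t\<close> and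
  then \<open>s\<close> leaves a polynomial identity in \<open>\<theta>\<close> and
  \<open>t'\<close>.\<close>

lemma variance_identity:
  fixes s t t' \<theta> :: int
  assumes t: "t = s * t'" and \<theta>: "(\<theta> - 1) * t' = s"
  shows "(t + 1) * ((s + t) * (t - t')) - 2 * (t' + 1) * ((t + 1) * (s * (t - t')))
      + (t' + 1)^2 * ((1 + s) * s * (t - t'))
    = \<theta> * (t - t')^2 + \<theta> * ((t + 1) * (s - 1)) * t'^2"
  unfolding t \<theta>[symmetric] by algebra

section \<open>Counting in a finite generalized quadrangle\<close>

locale gq =
  fixes S :: "('p, 'l) geometry" and s t :: nat
  assumes finite_geometry: "finite_geometry S"
    and quadrangle: "generalized_quadrangle S s t"
begin

lemma finite_points [simp]: "finite (points S)" and finite_lines [simp]: "finite (lines S)"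
  using finite_geometry by (auto simp: finite_geometry_def)

lemma lines_nonempty: "lines S \<noteq> {}"
  using quadrangle by (auto simp: generalized_quadrangle_def partial_linear_space_def)

lemma card_line: "L \<in> lines S \<Longrightarrow> card {x \<in> points S. inc S x L} = s + 1"
  and card_pencil: "x \<in> points S \<Longrightarrow> card {L \<in> lines S. inc S x L} = t + 1"
  using quadrangle by (auto simp: generalized_quadrangle_def partial_linear_space_def)

lemma line_unique:
  "\<lbrakk>x \<in> points S; y \<in> points S; L \<in> lines S; M \<in> lines S; x \<noteq> y;
    inc S x L; inc S y L; inc S x M; inc S y M\<rbrakk> \<Longrightarrow> L = M"
  using quadrangle unfolding generalized_quadrangle_def partial_linear_space_def by blast

lemma projection:
  assumes "x \<in> points S" "L \<in> lines S" "\<not> inc S x L"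
  shows "\<exists>!(y, M). y \<in> points S \<and> M \<in> lines S \<and> inc S x M \<and> inc S y M \<and> inc S y L"
  using quadrangle assms unfolding generalized_quadrangle_def by blast

lemma projection_exists:
  assumes "x \<in> points S" "L \<in> lines S" "\<not> inc S x L"
  obtains y where "y \<in> points S" "inc S y L" "collinear S x y"
  using ex1_implies_ex[OF projection[OF assms]] by (auto intro: collinearI)

lemma projection_unique:
  assumes x: "x \<in> points S" "L \<in> lines S" "\<not> inc S x L"
    and y: "y \<in> points S" "inc S y L" "collinear S x y"
    and z: "z \<in> points S" "inc S z L" "collinear S x z"
  shows "y = z"
proof -
  obtain M where M: "M \<in> lines S" "inc S x M" "inc S y M"
    using x y by (metis collinearE)
  obtain N where N: "N \<in> lines S" "inc S x N" "inc S z N"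
    using x z by (metis collinearE)
  have "(y, M) = (z, N)"
    using ex1_implies_ex[OF projection[OF x]] projection[OF x] M N y z
    by (elim ex1E) (metis (no_types, lifting) case_prodI)
  then show ?thesis by simp
qed

text \<open>If \<open>z\<close> were off \<open>L\<close>, it would have the two projections
  \<open>x\<close> and \<open>y\<close> on \<open>L\<close>.\<close>

lemma no_triangle:
  assumes "L \<in> lines S" "x \<in> points S" "y \<in> points S" "z \<in> points S" "x \<noteq> y"
    "inc S x L" "inc S y L" "collinear S z x" "collinear S z y"
  shows "inc S z L"
  using assms projection_unique by blast

lemma card_line_projection:
  assumes "x \<in> points S" "L \<in> lines S" "\<not> inc S x L"
  shows "card {y \<in> points S. inc S y L \<and> collinear S x y} = 1"
proof -
  obtain y where "y \<in> points S" "inc S y L" "collinear S x y"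
    using projection_exists assms by blast
  with assms show ?thesis
    by (intro card_eq_1I[of y]) (auto dest: projection_unique)
qed

lemma card_joining_lines:
  assumes "x \<in> points S" "y \<in> points S" "collinear S x y" "x \<noteq> y"
  shows "card {L \<in> lines S. inc S x L \<and> inc S y L} = 1"
proof -
  obtain L where "L \<in> lines S" "inc S x L" "inc S y L"
    using assms collinearE by metis
  with assms show ?thesis
    by (intro card_eq_1I[of L]) (auto dest: line_unique)
qed

lemma card_neighbours:
  assumes x: "x \<in> points S"
  shows "card {y \<in> points S. collinear S x y \<and> y \<noteq> x} = (t + 1) * s"
proof -
  have "card {L \<in> lines S. inc S x L} * s = card {y \<in> points S. collinear S x y \<and> y \<noteq> x} * 1"
  proof (rule sum_multicount_eq[where R = "\<lambda>L y. inc S y L"])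
    fix L assume L: "L \<in> {L \<in> lines S. inc S x L}"
    have "{y \<in> {y \<in> points S. collinear S x y \<and> y \<noteq> x}. inc S y L} =
        {y \<in> points S. inc S y L} - {x}"
      using L by (auto intro: collinearI)
    then show "card {y \<in> {y \<in> points S. collinear S x y \<and> y \<noteq> x}. inc S y L} = s"
      using L x card_line[of L] by simp
  next
    fix y assume "y \<in> {y \<in> points S. collinear S x y \<and> y \<noteq> x}"
    then show "card {L \<in> {L \<in> lines S. inc S x L}. inc S y L} = 1"
      using card_joining_lines[of x y] x by auto
  qed auto
  then show ?thesis
    using card_pencil[OF x] by simp
qed

lemma card_perp:
  assumes x: "x \<in> points S"
  shows "card (perp S x) = (t + 1) * s + 1"
proof -
  have "perp S x = insert x {y \<in> points S. collinear S x y \<and> y \<noteq> x}"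
    using x by (auto simp: perp_def)
  then show ?thesis
    using card_neighbours[OF x] by simp
qed

lemma finite_perp [simp]: "finite (perp S x)"
  by (simp add: perp_def)

text \<open>No line through \<open>x\<close> contains \<open>y\<close>, so each of these
  \<open>t + 1\<close> lines carries exactly one neighbour of \<open>y\<close>, and distinct lines
  carry distinct ones.\<close>

lemma card_trace:
  assumes x: "x \<in> points S" and y: "y \<in> points S" and xy: "\<not> collinear S x y"
  shows "card (perp S x \<inter> perp S y) = t + 1"
proof -
  have "card {L \<in> lines S. inc S x L} * 1 = card (perp S x \<inter> perp S y) * 1"
  proof (rule sum_multicount_eq[where R = "\<lambda>L y. inc S y L"])
    fix L assume L: "L \<in> {L \<in> lines S. inc S x L}"
    then have "\<not> inc S y L"
      using xy by (auto intro: collinearI)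
    moreover have "{w \<in> perp S x \<inter> perp S y. inc S w L} =
        {w \<in> points S. inc S w L \<and> collinear S y w}"
      using L by (auto simp: perp_def intro: collinearI)
    ultimately show "card {w \<in> perp S x \<inter> perp S y. inc S w L} = 1"
      using card_line_projection[OF y, of L] L by simp
  next
    fix w assume "w \<in> perp S x \<inter> perp S y"
    then have "w \<in> points S" "collinear S x w" "x \<noteq> w"
      using xy by (auto simp: perp_def collinear_commute)
    then show "card {L \<in> {L \<in> lines S. inc S x L}. inc S w L} = 1"
      using card_joining_lines[of x w] x by auto
  qed auto
  then show ?thesis
    using card_pencil[OF x] by simp
qed

text \<open>Fix a line \<open>L\<close> and count collinear pairs of a point of \<open>S\<close> and
  a point of \<open>L\<close>: a point on \<open>L\<close> sees all \<open>s + 1\<close> points of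
  \<open>L\<close>, any other point exactly one.\<close>

lemma card_points: "card (points S) = (1 + s) * (1 + s * t)"
proof -
  obtain L where L: "L \<in> lines S"
    using lines_nonempty by auto
  let ?L = "{x \<in> points S. inc S x L}"
  have "(\<Sum>x\<in>points S. card {p \<in> ?L. collinear S x p}) = (\<Sum>p\<in>?L. (t + 1) * s + 1)"
  proof (intro sum_multicount_gen ballI)
    fix p assume "p \<in> ?L"
    moreover have "{x \<in> points S. collinear S x p} = perp S p"
      unfolding perp_def collinear_commute[of S p] ..
    ultimately show "card {x \<in> points S. collinear S x p} = (t + 1) * s + 1"
      using card_perp by simp
  qed auto
  also have "\<dots> = (s + 1) * ((t + 1) * s + 1)"
    using card_line[OF L] by simp
  also have "(\<Sum>x\<in>points S. card {p \<in> ?L. collinear S x p}) =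
      (\<Sum>x\<in>points S. if inc S x L then s + 1 else 1)"
  proof (intro sum.cong refl)
    fix x assume x: "x \<in> points S"
    have "{p \<in> ?L. collinear S x p} = ?L" if "inc S x L"
      using that L by (auto intro: collinearI)
    moreover have "{p \<in> ?L. collinear S x p} = {y \<in> points S. inc S y L \<and> collinear S x y}"
      by auto
    ultimately show "card {p \<in> ?L. collinear S x p} = (if inc S x L then s + 1 else 1)"
      using card_line[OF L] card_line_projection[OF x L] by simp
  qed
  also have "\<dots> = (\<Sum>x\<in>points S. (if inc S x L then s else 0) + 1)"
    by (intro sum.cong) auto
  also have "\<dots> = card ?L * s + card (points S)"
    unfolding sum.distrib by (simp add: sum.If_cases Int_def)
  finally show ?thesis
    using card_line[OF L] by (simp add: algebra_simps)
qed

text \<open>Counting flags, each line has \<open>s + 1\<close> points but only one in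
  \<open>A\<close>, while every point is on \<open>t + 1\<close> lines; hence there are
  \<open>s + 1\<close> times as many points as elements of \<open>A\<close>.\<close>

lemma card_ovoid:
  assumes "ovoid S A"
  shows "card A = s * t + 1"
proof -
  have A: "A \<subseteq> points S" "\<And>L. L \<in> lines S \<Longrightarrow> \<exists>!y. y \<in> A \<and> inc S y L"
    using assms unfolding ovoid_def by blast+
  have "card (points S) * (t + 1) = card (lines S) * (s + 1)"
    by (rule sum_multicount_eq[where R = "inc S"]) (simp_all add: card_line card_pencil)
  moreover have "card A * (t + 1) = card (lines S) * 1"
  proof (rule sum_multicount_eq[where R = "inc S"])
    fix L assume "L \<in> lines S"
    then obtain y where "y \<in> A \<and> inc S y L" "\<And>z. z \<in> A \<and> inc S z L \<Longrightarrow> z = y"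
      using A(2) by metis
    then show "card {a \<in> A. inc S a L} = 1"
      by (intro card_eq_1I[of y]) blast+
  qed (use A(1) card_pencil finite_subset[OF A(1)] in auto)
  ultimately have "(1 + s) * (1 + s * t) * (t + 1) = card A * (t + 1) * (s + 1)"
    unfolding card_points by simp
  also have "\<dots> = card A * ((1 + s) * (t + 1))"
    by (simp only: ac_simps)
  also have "(1 + s) * (1 + s * t) * (t + 1) = (s * t + 1) * ((1 + s) * (t + 1))"
    by (simp only: ac_simps)
  finally show ?thesis
    by (subst (asm) mult_cancel2) simp
qed

end

section \<open>The subquadrangle, its external points and the subtended ovoids\<close>

locale subq = gq S s t + sub: gq S' s t'
  for S S' :: "('p, 'l) geometry" and s t t' \<theta> :: nat +
  assumes subquadrangle: "proper_subquadrangle S' S s t'"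
    and s_ge_2: "s \<ge> 2"
    and t'_ge_1: "t' \<ge> 1"
    and t_eq: "t = s * t'"
    and \<theta>_eq: "(\<theta> - 1) * t' = s"
    and \<theta>_gt_1: "\<theta> > 1"
    and \<theta>_subtended: "\<And>x. x \<in> points S - points S' \<Longrightarrow> theta_subtended S S' \<theta> (subtended S S' x)"
begin

abbreviation Ext :: "'p set" where "Ext \<equiv> points S - points S'"
abbreviation Ov :: "'p \<Rightarrow> 'p set" ("\<O>") where "\<O> \<equiv> subtended S S'"
abbreviation twins :: "'p \<Rightarrow> 'p set" where "twins x \<equiv> {x' \<in> Ext. \<O> x' = \<O> x}"
text \<open>For a line outside \<open>S'\<close> this is its rosette, written without naming the
  point of \<open>S'\<close> on it.\<close>

abbreviation ros :: "'l \<Rightarrow> 'p set set" where "ros L \<equiv> \<O> ` {y \<in> Ext. inc S y L}"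

lemma points_sub: "x \<in> points S' \<Longrightarrow> x \<in> points S"
  and lines_sub: "L \<in> lines S' \<Longrightarrow> L \<in> lines S"
  and inc_sub: "x \<in> points S' \<Longrightarrow> L \<in> lines S' \<Longrightarrow> inc S' x L \<longleftrightarrow> inc S x L"
  using subquadrangle by (auto simp: proper_subquadrangle_def subgeometry_def)

lemma points_sub': "points S' \<subseteq> points S"
  using points_sub by blast

text \<open>Lines have \<open>s + 1\<close> points in both quadrangles, so a line of
  \<open>S'\<close> gains no point in \<open>S\<close>.\<close>

lemma point_on_sub_line:
  assumes L: "L \<in> lines S'" and x: "x \<in> points S" "inc S x L"
  shows "x \<in> points S'"
proof -
  have "{y \<in> points S'. inc S' y L} = {y \<in> points S. inc S y L}"
    using L points_sub inc_sub sub.card_line[OF L] card_line[OF lines_sub[OF L]]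
    by (intro card_subset_eq) auto
  then show ?thesis
    using x by blast
qed

text \<open>Project \<open>y\<close> inside \<open>S'\<close> onto a line of \<open>S'\<close>
  through \<open>x\<close>. If the projection were not \<open>x\<close>, it would form a triangle of
  \<open>S\<close> with \<open>x\<close> and \<open>y\<close>.\<close>

lemma collinear_sub:
  assumes x: "x \<in> points S'" and y: "y \<in> points S'"
  shows "collinear S' x y \<longleftrightarrow> collinear S x y"
proof
  assume "collinear S' x y"
  then show "collinear S x y"
    using x y inc_sub lines_sub by (auto simp: collinear_def)
next
  assume xy: "collinear S x y"
  show "collinear S' x y"
  proof (rule ccontr)
    assume n: "\<not> collinear S' x y"
    obtain L where L: "L \<in> lines S'" "inc S' x L"
      using sub.card_pencil[OF x] by (metis (mono_tags, lifting) Collect_empty_eq card.empty add_is_0 one_neq_zero)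
    then have "\<not> inc S' y L"
      using n by (auto intro: collinearI)
    then obtain w where w: "w \<in> points S'" "inc S' w L" "collinear S' y w"
      using sub.projection_exists y L by blast
    then have "w \<noteq> x"
      using n by (auto simp: collinear_commute)
    have "collinear S y w"
      using w y inc_sub lines_sub by (auto simp: collinear_def)
    then have "inc S y L"
      using no_triangle[of L x w y] xy x y w L inc_sub lines_sub points_sub \<open>w \<noteq> x\<close>
      by (auto simp: collinear_commute)
    then show False
      using \<open>\<not> inc S' y L\<close> inc_sub L y by blast
  qed
qed

lemma line_in_sub:
  assumes "L \<in> lines S" "x \<in> points S'" "y \<in> points S'" "x \<noteq> y" "inc S x L" "inc S y L"
  shows "L \<in> lines S'"
proof -
  have "collinear S' x y"
    using assms collinear_sub by (auto intro: collinearI)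
  then obtain M where "M \<in> lines S'" "inc S' x M" "inc S' y M"
    using assms collinearE by metis
  moreover from this have "M = L"
    using line_unique[of x y M L] assms inc_sub lines_sub points_sub by auto
  ultimately show ?thesis by simp
qed

text \<open>A second common point with \<open>S'\<close> would put \<open>L\<close>, and hence
  \<open>x\<close>, into \<open>S'\<close>.\<close>

lemma tangent_unique:
  assumes "x \<in> Ext" "L \<in> lines S" "inc S x L"
    and "z \<in> points S'" "z' \<in> points S'" "inc S z L" "inc S z' L"
  shows "z = z'"
  using assms line_in_sub point_on_sub_line by (metis DiffE)

lemma ext_line_iff: "x \<in> Ext \<Longrightarrow> L \<in> lines S \<Longrightarrow> inc S x L \<Longrightarrow> L \<notin> lines S'"
  using point_on_sub_line by auto

lemma mem_Ov: "w \<in> \<O> x \<longleftrightarrow> w \<in> points S' \<and> collinear S x w"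
  using points_sub by (auto simp: subtended_def perp_def)

lemma finite_Ov [simp]: "finite (\<O> x)"
  by (simp add: subtended_def)

lemma ovoid_Ov: "x \<in> Ext \<Longrightarrow> ovoid S' (\<O> x)"
  by (rule ovoid_subtended[OF quadrangle subquadrangle])

text \<open>Here \<open>t = s * t'\<close> enters: the ovoid has as many points as there are lines
  through \<open>x\<close>, and as many as the trace of two non-collinear points.\<close>

lemma card_Ov: "x \<in> Ext \<Longrightarrow> card (\<O> x) = t + 1"
  using sub.card_ovoid[OF ovoid_Ov] t_eq by simp

lemma Ov_not_collinear:
  assumes x: "x \<in> Ext" and w: "w \<in> \<O> x" "w' \<in> \<O> x" "collinear S w w'"
  shows "w = w'"
proof (rule ccontr)
  assume "w \<noteq> w'"
  moreover have "collinear S' w w'"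
    using w collinear_sub mem_Ov by blast
  ultimately obtain L where "L \<in> lines S'" "inc S' w L" "inc S' w' L"
    using collinearE by metis
  then show False
    using ovoid_Ov[OF x] w \<open>w \<noteq> w'\<close> unfolding ovoid_def by blast
qed

text \<open>The \<open>t + 1\<close> points of \<open>\<O> x\<close> lie on distinct lines through \<open>x\<close>, which therefore are
  all the lines through \<open>x\<close>.\<close>

lemma tangent_exists:
  assumes x: "x \<in> Ext" and L: "L \<in> lines S" "inc S x L"
  obtains z where "z \<in> points S'" "inc S z L"
proof -
  define line where "line w = (SOME M. M \<in> lines S \<and> inc S x M \<and> inc S w M)" for w
  have line: "line w \<in> lines S \<and> inc S x (line w) \<and> inc S w (line w)" if "w \<in> \<O> x" for w
  proof -
    have "collinear S x w" "x \<noteq> w"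
      using that x by (auto simp: mem_Ov)
    then obtain M where "M \<in> lines S \<and> inc S x M \<and> inc S w M"
      by (auto elim: collinearE)
    then show ?thesis
      unfolding line_def by (rule someI)
  qed
  have "inj_on line (\<O> x)"
  proof
    fix w w' assume w: "w \<in> \<O> x" "w' \<in> \<O> x" "line w = line w'"
    then have "collinear S w w'"
      using line by (metis collinearI)
    then show "w = w'"
      using Ov_not_collinear x w by blast
  qed
  then have "line ` \<O> x = {M \<in> lines S. inc S x M}"
    using x card_Ov card_pencil[of x] line
    by (intro card_subset_eq) (auto simp: card_image)
  then have "L \<in> line ` \<O> x"
    using L by simp
  then obtain w where "w \<in> \<O> x" "L = line w"
    by (rule imageE)
  with line[of w] that[of w] show thesis
    by (simp add: mem_Ov)
qed

text \<open>A point seen from both \<open>x\<close> and \<open>y\<close> lies on \<open>L\<close>,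
  as there are no triangles, and \<open>L\<close> meets \<open>S'\<close> only in
  \<open>z\<close>.\<close>

lemma Ov_Int_collinear:
  assumes x: "x \<in> Ext" and y: "y \<in> Ext" and xy: "x \<noteq> y"
    and L: "L \<in> lines S" "inc S x L" "inc S y L" and z: "z \<in> points S'" "inc S z L"
  shows "\<O> x \<inter> \<O> y = {z}"
proof (intro set_eqI iffI)
  fix w assume "w \<in> \<O> x \<inter> \<O> y"
  then have w: "w \<in> points S'" "collinear S x w" "collinear S y w"
    by (auto simp: mem_Ov)
  then have "inc S w L"
    using no_triangle[of L x y w] x y xy L points_sub by (auto simp: collinear_commute)
  then show "w \<in> {z}"
    using tangent_unique x L z w by auto
qed (use L z in \<open>auto simp: mem_Ov intro: collinearI\<close>)

lemma card_Ov_Int_collinear: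
  assumes "x \<in> Ext" "y \<in> Ext" "x \<noteq> y" "collinear S x y"
  shows "card (\<O> x \<inter> \<O> y) = 1"
proof -
  obtain L where L: "L \<in> lines S" "inc S x L" "inc S y L"
    using assms collinearE by metis
  moreover obtain z where "z \<in> points S'" "inc S z L"
    using tangent_exists assms L by metis
  ultimately show ?thesis
    using Ov_Int_collinear assms by simp
qed

lemma t_ge_2: "t \<ge> 2"
  using s_ge_2 t'_ge_1 t_eq mult_le_mono[of 2 s 1 t'] by simp

text \<open>Ovoids of distinct collinear points share one point, but those of twins share all
  \<open>t + 1\<close>.\<close>

lemma twins_not_collinear:
  assumes "x \<in> Ext" "y \<in> Ext" "x \<noteq> y" "\<O> x = \<O> y"
  shows "\<not> collinear S x y"
  using assms card_Ov_Int_collinear[of x y] card_Ov[of x] t_ge_2 by auto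

text \<open>The trace of two twins has \<open>t + 1\<close> points, hence it is the ovoid they subtend and contains
  no point outside \<open>S'\<close>.\<close>

lemma collinear_twin_unique:
  assumes x: "x \<in> Ext" "x' \<in> Ext" "\<O> x = \<O> x'" and y: "y \<in> Ext"
    and xy: "collinear S x y" "collinear S x' y"
  shows "x = x'"
proof (rule ccontr)
  assume ne: "x \<noteq> x'"
  have "\<not> collinear S x x'"
    using twins_not_collinear x ne by blast
  then have "card (perp S x \<inter> perp S x') = t + 1"
    using card_trace x by blast
  moreover have "\<O> x \<subseteq> perp S x \<inter> perp S x'"
    using x(3) unfolding subtended_def by blast
  ultimately have "\<O> x = perp S x \<inter> perp S x'"
    using card_Ov[OF x(1)] by (intro card_subset_eq) simp_all
  moreover have "y \<in> perp S x \<inter> perp S x'"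
    using xy y by (auto simp: perp_def)
  ultimately show False
    using y mem_Ov by auto
qed

lemma card_twins: "x \<in> Ext \<Longrightarrow> card (twins x) = \<theta>"
  using \<theta>_subtended unfolding theta_subtended_def by blast

section \<open>Counting external points, and the moments of the intersection sizes\<close>

lemma card_ext_neighbours:
  assumes w: "w \<in> points S'"
  shows "card {y \<in> Ext. collinear S w y} = s * (t - t')"
proof -
  have "{y \<in> Ext. collinear S w y} = perp S w - perp S' w"
    using w collinear_sub by (auto simp: perp_def)
  moreover have "perp S' w \<subseteq> perp S w"
    using w collinear_sub points_sub by (auto simp: perp_def)
  ultimately have "card {y \<in> Ext. collinear S w y} = ((t + 1) * s + 1) - ((t' + 1) * s + 1)"
    using card_perp sub.card_perp w points_sub by (simp add: card_Diff_subset)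
  then show ?thesis
    by (simp add: algebra_simps diff_mult_distrib2)
qed

lemma card_ext_common_neighbours:
  assumes w: "w \<in> points S'" "w' \<in> points S'" "\<not> collinear S w w'"
  shows "card {y \<in> Ext. collinear S w y \<and> collinear S w' y} = t - t'"
proof -
  have "{y \<in> Ext. collinear S w y \<and> collinear S w' y} =
      (perp S w \<inter> perp S w') - (perp S' w \<inter> perp S' w')"
    using w collinear_sub by (auto simp: perp_def)
  moreover have "perp S' w \<inter> perp S' w' \<subseteq> perp S w \<inter> perp S w'"
    using w collinear_sub points_sub by (auto simp: perp_def)
  moreover have "card (perp S' w \<inter> perp S' w') = t' + 1"
    using w collinear_sub by (intro sub.card_trace) auto
  moreover have "card (perp S w \<inter> perp S w') = t + 1"
    using w points_sub by (intro card_trace) auto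
  ultimately show ?thesis
    by (simp add: card_Diff_subset)
qed

lemma card_ext: "card Ext = (1 + s) * s * (t - t')"
proof -
  have "card Ext = (1 + s) * (1 + s * t) - (1 + s) * (1 + s * t')"
    using card_points sub.card_points points_sub' by (simp add: card_Diff_subset)
  also have "\<dots> = (1 + s) * (s * t - s * t')"
    by (simp only: diff_mult_distrib2[symmetric] add_diff_cancel_left)
  also have "\<dots> = (1 + s) * s * (t - t')"
    by (simp only: diff_mult_distrib2[symmetric] mult.assoc)
  finally show ?thesis .
qed

lemma card_ext_neighbours_ext:
  assumes x: "x \<in> Ext"
  shows "card {y \<in> Ext. collinear S x y \<and> y \<noteq> x} = (t + 1) * (s - 1)"
proof -
  have "{y \<in> Ext. collinear S x y \<and> y \<noteq> x} = {y \<in> points S. collinear S x y \<and> y \<noteq> x} - \<O> x"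
    by (auto simp: mem_Ov)
  moreover have "\<O> x \<subseteq> {y \<in> points S. collinear S x y \<and> y \<noteq> x}"
    using x points_sub by (auto simp: mem_Ov)
  ultimately have "card {y \<in> Ext. collinear S x y \<and> y \<noteq> x} = (t + 1) * s - (t + 1)"
    using card_neighbours[of x] card_Ov[OF x] x by (simp add: card_Diff_subset)
  then show ?thesis
    by (simp add: algebra_simps diff_mult_distrib2)
qed

text \<open>First moment: count pairs of a point of \<open>\<O> x\<close> and an external neighbour
  of it.\<close>

lemma sum_card_Ov_Int:
  assumes x: "x \<in> Ext"
  shows "(\<Sum>y\<in>Ext. card (\<O> x \<inter> \<O> y)) = (t + 1) * (s * (t - t'))"
proof -
  have "(\<Sum>y\<in>Ext. card {w \<in> \<O> x. collinear S w y}) = (\<Sum>w\<in>\<O> x. s * (t - t'))"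
    using card_ext_neighbours by (intro sum_multicount_gen) (auto simp: mem_Ov)
  moreover have "{w \<in> \<O> x. collinear S w y} = \<O> x \<inter> \<O> y" for y
    by (auto simp: mem_Ov collinear_commute)
  ultimately show ?thesis
    using card_Ov[OF x] by simp
qed

text \<open>Second moment: count triples of two points of \<open>\<O> x\<close> and an external
  common neighbour. Two different points of an ovoid are never collinear, so their number of
  external common neighbours is constant.\<close>

lemma sum_card_Ov_Int_squared:
  assumes x: "x \<in> Ext"
  shows "(\<Sum>y\<in>Ext. card (\<O> x \<inter> \<O> y) ^ 2) = (t + 1) * ((s + t) * (t - t'))"
proof -
  let ?k = "\<lambda>(w, w'). if w = w' then s * (t - t') else t - t'"
  have "(\<Sum>y\<in>Ext. card {p \<in> \<O> x \<times> \<O> x. collinear S (fst p) y \<and> collinear S (snd p) y}) =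
      (\<Sum>p\<in>\<O> x \<times> \<O> x. ?k p)"
  proof (intro sum_multicount_gen ballI)
    fix p assume "p \<in> \<O> x \<times> \<O> x"
    then obtain w w' where p: "p = (w, w')" and w: "w \<in> \<O> x" "w' \<in> \<O> x"
      by auto
    show "card {y \<in> Ext. collinear S (fst p) y \<and> collinear S (snd p) y} = ?k p"
      using p w card_ext_neighbours[of w] card_ext_common_neighbours[of w w']
        Ov_not_collinear[OF x w] by (auto simp: mem_Ov)
  qed auto
  also have "\<dots> = (\<Sum>w\<in>\<O> x. \<Sum>w'\<in>\<O> x. if w = w' then s * (t - t') else t - t')"
    by (simp add: sum.cartesian_product)
  also have "\<dots> = (\<Sum>w\<in>\<O> x. s * (t - t') + t * (t - t'))"
  proof (intro sum.cong refl)
    fix w assume w: "w \<in> \<O> x"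
    \<comment> \<open>Split off the diagonal term; \<open>t\<close> points of \<open>\<O> x\<close>
      remain.\<close>
    have "(\<Sum>w'\<in>\<O> x. if w = w' then s * (t - t') else t - t') =
        s * (t - t') + (\<Sum>w'\<in>\<O> x - {w}. if w = w' then s * (t - t') else t - t')"
      using w by (simp add: sum.remove)
    also have "(\<Sum>w'\<in>\<O> x - {w}. if w = w' then s * (t - t') else t - t') =
        (\<Sum>w'\<in>\<O> x - {w}. t - t')"
      by (intro sum.cong) auto
    also have "\<dots> = t * (t - t')"
      using w card_Ov[OF x] by simp
    finally show "(\<Sum>w'\<in>\<O> x. if w = w' then s * (t - t') else t - t') =
        s * (t - t') + t * (t - t')" .
  qed
  also have "\<dots> = (t + 1) * ((s + t) * (t - t'))"
    using card_Ov[OF x] by (simp add: algebra_simps)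
  also have "(\<Sum>y\<in>Ext. card {p \<in> \<O> x \<times> \<O> x. collinear S (fst p) y \<and> collinear S (snd p) y}) =
      (\<Sum>y\<in>Ext. card (\<O> x \<inter> \<O> y) ^ 2)"
  proof (intro sum.cong refl)
    fix y
    have "{p \<in> \<O> x \<times> \<O> x. collinear S (fst p) y \<and> collinear S (snd p) y} =
        (\<O> x \<inter> \<O> y) \<times> (\<O> x \<inter> \<O> y)"
      by (auto simp: mem_Ov collinear_commute)
    then show "card {p \<in> \<O> x \<times> \<O> x. collinear S (fst p) y \<and> collinear S (snd p) y} =
        card (\<O> x \<inter> \<O> y) ^ 2"
      by (simp add: card_cartesian_product power2_eq_square)
  qed
  finally show ?thesis .
qed

section \<open>Tied points and the possible intersection sizes\<close>

definition tied :: "'p \<Rightarrow> 'p set" where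
  "tied x = {y \<in> Ext. \<O> y \<noteq> \<O> x \<and> (\<exists>x'\<in>twins x. collinear S x' y)}"

lemma card_collinear_twins:
  assumes y: "y \<in> tied x"
  shows "card {x' \<in> twins x. collinear S x' y} = 1"
proof -
  obtain x' where x': "x' \<in> twins x" "collinear S x' y"
    using y by (auto simp: tied_def)
  then show ?thesis
    using y collinear_twin_unique
    by (intro card_eq_1I[of x']) (auto simp: tied_def)
qed

text \<open>The external neighbours of the \<open>\<theta>\<close> twins form disjoint sets, and
  none of them is itself a twin.\<close>

lemma card_tied:
  assumes x: "x \<in> Ext"
  shows "card (tied x) = \<theta> * ((t + 1) * (s - 1))"
proof -
  have "card (twins x) * ((t + 1) * (s - 1)) = card (tied x) * 1"
  proof (rule sum_multicount_eq[where R = "collinear S"])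
    fix x' assume x': "x' \<in> twins x"
    then have "{y \<in> tied x. collinear S x' y} = {y \<in> Ext. collinear S x' y \<and> y \<noteq> x'}"
      using twins_not_collinear by (auto simp: tied_def)
    then show "card {y \<in> tied x. collinear S x' y} = (t + 1) * (s - 1)"
      using card_ext_neighbours_ext x' by simp
  next
    fix y assume "y \<in> tied x"
    then show "card {x' \<in> twins x. collinear S x' y} = 1"
      by (rule card_collinear_twins)
  qed (auto simp: tied_def)
  then show ?thesis
    using card_twins[OF x] by simp
qed

lemma card_Ov_Int_tied:
  assumes "x \<in> Ext" "y \<in> tied x"
  shows "card (\<O> x \<inter> \<O> y) = 1"
proof -
  from assms obtain x' where "x' \<in> Ext" "\<O> x' = \<O> x" "collinear S x' y" "x' \<noteq> y" "y \<in> Ext"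
    by (auto simp: tied_def)
  then show ?thesis
    using card_Ov_Int_collinear[of x' y] by simp
qed

text \<open>The \<open>\<theta>\<close> twins of \<open>x\<close> and the points tied to \<open>x\<close> account for the entire sum of
  \<open>(\<bar>\<O> x \<inter> \<O> y\<bar> - (t' + 1))\<^sup>2\<close> over all external \<open>y\<close>. This uses \<open>(\<theta> - 1) t' = s\<close>.\<close>

lemma card_Ov_Int_not_tied:
  assumes x: "x \<in> Ext" and y: "y \<in> Ext" "\<O> y \<noteq> \<O> x" "y \<notin> tied x"
  shows "card (\<O> x \<inter> \<O> y) = t' + 1"
proof -
  let ?b = "\<lambda>y. int (card (\<O> x \<inter> \<O> y))"
  let ?f = "\<lambda>y. (?b y - (int t' + 1))^2"
  let ?rest = "Ext - twins x - tied x"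
  have diff_int: "int (t - t') = int t - int t'"
    using t_eq s_ge_2 by (simp add: of_nat_diff)
  have s_int: "int (s - 1) = int s - 1"
    using s_ge_2 by (simp add: of_nat_diff)
  have t_int: "int t = int s * int t'"
    using t_eq by simp
  have \<theta>_int: "(int \<theta> - 1) * int t' = int s"
    using \<theta>_gt_1 by (simp add: of_nat_diff flip: \<theta>_eq)
  have "(\<Sum>y\<in>Ext. ?f y) = (\<Sum>y\<in>Ext. ?b y ^ 2 - 2 * (int t' + 1) * ?b y + (int t' + 1)^2)"
    by (intro sum.cong) (auto simp: power2_eq_square algebra_simps)
  also have "\<dots> = (\<Sum>y\<in>Ext. ?b y ^ 2) - 2 * (int t' + 1) * (\<Sum>y\<in>Ext. ?b y)
      + (int t' + 1)^2 * int (card Ext)"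
    by (simp add: sum.distrib sum_subtractf sum_distrib_left)
  also have "(\<Sum>y\<in>Ext. ?b y) = int ((t + 1) * (s * (t - t')))"
    using sum_card_Ov_Int[OF x] by (metis of_nat_sum)
  also have "(\<Sum>y\<in>Ext. ?b y ^ 2) = int ((t + 1) * ((s + t) * (t - t')))"
    unfolding sum_card_Ov_Int_squared[OF x, symmetric] by simp
  \<comment> \<open>With all three moments explicit, the variance identity evaluates the
    sum.\<close>
  also have "int ((t + 1) * ((s + t) * (t - t'))) - 2 * (int t' + 1) * int ((t + 1) * (s * (t - t')))
      + (int t' + 1)^2 * int (card Ext)
    = int \<theta> * (int t - int t')^2 + int \<theta> * ((int t + 1) * (int s - 1)) * (int t')^2"
    using variance_identity[OF t_int \<theta>_int]
    by (simp only: card_ext diff_int of_nat_mult of_nat_add of_nat_1)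
  \<comment> \<open>For a twin the intersection has \<open>t + 1\<close> points and deviates by
    \<open>t - t'\<close>; for a tied point it has one and deviates by \<open>-t'\<close>.\<close>
  also have "\<dots> = (\<Sum>y\<in>twins x. ?f y) + (\<Sum>y\<in>tied x. ?f y)"
  proof -
    have "(\<Sum>y\<in>twins x. ?f y) = (\<Sum>y\<in>twins x. (int t - int t')^2)"
      using card_Ov[OF x] by (intro sum.cong) auto
    moreover have "(\<Sum>y\<in>tied x. ?f y) = (\<Sum>y\<in>tied x. (int t')^2)"
    proof (intro sum.cong refl)
      fix y assume "y \<in> tied x"
      then show "?f y = (int t')^2"
        using card_Ov_Int_tied[OF x, of y] by simp
    qed
    ultimately show ?thesis
      using s_int by (simp only: sum_constant card_twins[OF x] card_tied[OF x] of_nat_mult of_nat_add of_nat_1)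
  qed
  also have "(\<Sum>y\<in>Ext. ?f y) = (\<Sum>y\<in>twins x. ?f y) + (\<Sum>y\<in>tied x. ?f y) + (\<Sum>y\<in>?rest. ?f y)"
  proof -
    have "(\<Sum>y\<in>Ext. ?f y) = (\<Sum>y\<in>Ext - twins x. ?f y) + (\<Sum>y\<in>twins x. ?f y)"
      by (intro sum.subset_diff) auto
    moreover have "(\<Sum>y\<in>Ext - twins x. ?f y) = (\<Sum>y\<in>?rest. ?f y) + (\<Sum>y\<in>tied x. ?f y)"
      by (intro sum.subset_diff) (auto simp: tied_def)
    ultimately show ?thesis by simp
  qed
  \<comment> \<open>The remaining squares sum to zero, so each of them vanishes.\<close>
  finally have "(\<Sum>y\<in>?rest. ?f y) = 0"
    by simp
  then have "\<forall>y\<in>?rest. ?f y = 0"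
    by (subst (asm) sum_nonneg_eq_0_iff) auto
  then have "?f y = 0"
    using y by blast
  then show ?thesis
    by simp
qed

text \<open>The possible sizes are \<open>t + 1\<close> for twins, \<open>1\<close> for tied points
  and \<open>t' + 1\<close> otherwise, and \<open>1\<close> differs from the other two. Hence being
  tied is symmetric and depends on the ovoids only.\<close>

lemma tied_iff:
  assumes "x \<in> Ext" "y \<in> Ext"
  shows "y \<in> tied x \<longleftrightarrow> card (\<O> x \<inter> \<O> y) = 1"
proof
  assume *: "card (\<O> x \<inter> \<O> y) = 1"
  then have "\<O> y \<noteq> \<O> x"
    using assms card_Ov[of x] t_ge_2 by auto
  then show "y \<in> tied x"
    using * assms card_Ov_Int_not_tied[of x y] t'_ge_1 by fastforce
qed (use assms card_Ov_Int_tied in blast)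

lemma tied_commute: "x \<in> Ext \<Longrightarrow> y \<in> Ext \<Longrightarrow> y \<in> tied x \<longleftrightarrow> x \<in> tied y"
  by (simp add: tied_iff Int_commute)

section \<open>Lines outside the subquadrangle and their rosettes\<close>

lemma ext_line:
  assumes L: "L \<in> lines S - lines S'"
  obtains z where "z \<in> points S'" "inc S z L" "{y \<in> Ext. inc S y L} = {y \<in> points S. inc S y L} - {z}"
proof -
  obtain x where x: "x \<in> Ext" "inc S x L"
  proof (rule ccontr)
    assume "\<not> thesis"
    \<comment> \<open>Since \<open>s + 1 \<ge> 2\<close>, two points of \<open>L\<close> would lie
      in \<open>S'\<close> and force \<open>L\<close> into \<open>S'\<close>.\<close>
    then have "{y \<in> points S. inc S y L} \<subseteq> points S'"
      using that by blast
    moreover have "\<not> card {y \<in> points S. inc S y L} \<le> Suc 0"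
      using card_line L s_ge_2 by simp
    then obtain y y' where "y \<in> {y \<in> points S. inc S y L}" "y' \<in> {y \<in> points S. inc S y L}" "y \<noteq> y'"
      using card_le_Suc0_iff_eq[of "{y \<in> points S. inc S y L}"] by auto
    ultimately show False
      using line_in_sub L by blast
  qed
  then obtain z where z: "z \<in> points S'" "inc S z L"
    using tangent_exists L by blast
  moreover have "y = z" if "y \<in> points S'" "inc S y L" for y
    using tangent_unique x L z that by blast
  then have "{y \<in> Ext. inc S y L} = {y \<in> points S. inc S y L} - {z}"
    using z by blast
  ultimately show thesis
    by (rule that)
qed

lemma inj_on_Ov_line: "L \<in> lines S \<Longrightarrow> inj_on \<O> {y \<in> Ext. inc S y L}"
  by (rule inj_onI) (use twins_not_collinear collinearI in fastforce)

lemma card_ros: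
  assumes L: "L \<in> lines S - lines S'"
  shows "card (ros L) = s"
proof -
  obtain z where "z \<in> points S'" "inc S z L" "{y \<in> Ext. inc S y L} = {y \<in> points S. inc S y L} - {z}"
    using ext_line L by blast
  then have "card {y \<in> Ext. inc S y L} = s"
    using card_line[of L] L points_sub by simp
  then show ?thesis
    using card_image[OF inj_on_Ov_line] L by auto
qed

lemma rosettes_eq: "rosettes S S' = ros ` (lines S - lines S')"
proof -
  have *: "rosette S S' L z = ros L" if L: "L \<in> lines S - lines S'" and z: "z \<in> points S'" "inc S z L" for L z
  proof -
    obtain z' where z': "z' \<in> points S'" "inc S z' L" "{y \<in> Ext. inc S y L} = {y \<in> points S. inc S y L} - {z'}"
      using ext_line L by blast
    then have "z = z'"
      using line_in_sub L z by blast
    moreover have "{x \<in> points S. inc S x L \<and> x \<noteq> z} = {y \<in> points S. inc S y L} - {z}"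
      by blast
    ultimately show ?thesis
      using z' unfolding rosette_def by simp
  qed
  show ?thesis
  proof (intro equalityI subsetI)
    fix R assume "R \<in> rosettes S S'"
    then show "R \<in> ros ` (lines S - lines S')"
      using * unfolding rosettes_def by blast
  next
    fix R assume "R \<in> ros ` (lines S - lines S')"
    then obtain L where L: "L \<in> lines S - lines S'" "R = ros L"
      by blast
    moreover obtain z where "z \<in> points S'" "inc S z L"
      using ext_line L by blast
    ultimately show "R \<in> rosettes S S'"
      using * unfolding rosettes_def by blast
  qed
qed

text \<open>For \<open>y\<close> on \<open>L\<close> other than \<open>x\<close>, the ovoids of
  \<open>y\<close> and \<open>x'\<close> meet only in \<open>z\<close>, so \<open>x'\<close> is
  collinear with a twin \<open>y'\<close> of \<open>y\<close>. The line joining \<open>x'\<close>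
  and \<open>y'\<close> meets \<open>S'\<close> in the common point \<open>z\<close> of their
  ovoids, so it is \<open>L'\<close>, and \<open>\<O> y\<close> lies in \<open>ros L'\<close>.
  Exchanging the roles of the two lines gives equality.\<close>

lemma ros_mono:
  assumes x: "x \<in> Ext" "x' \<in> Ext" "\<O> x = \<O> x'"
    and L: "L \<in> lines S" "inc S x L" "L' \<in> lines S" "inc S x' L'"
    and z: "z \<in> points S'" "inc S z L" "inc S z L'"
  shows "ros L \<subseteq> ros L'"
proof
  fix A assume "A \<in> ros L"
  then obtain y where y: "y \<in> Ext" "inc S y L" "A = \<O> y"
    by blast
  show "A \<in> ros L'"
  proof (cases "y = x")
    case False
    then have xy: "\<O> x \<inter> \<O> y = {z}"
      using Ov_Int_collinear x y L z by metis
    then have "x' \<in> tied y"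
      using x y tied_iff[of y x'] by (simp add: Int_commute)
    then obtain y' where y': "y' \<in> Ext" "\<O> y' = \<O> y" "collinear S y' x'" "y' \<noteq> x'"
      by (auto simp: tied_def)
    then obtain M where M: "M \<in> lines S" "inc S x' M" "inc S y' M"
      using collinearE by metis
    then obtain w where w: "w \<in> points S'" "inc S w M"
      using tangent_exists x by metis
    have "\<O> x' \<inter> \<O> y' = {w}"
      using Ov_Int_collinear[of x' y' M w] x y' M w by auto
    then have "w = z"
      using xy x y' by auto
    then have "M = L'"
      using line_unique[of x' z M L'] x z w M L points_sub by auto
    then show ?thesis
      using y y' M by blast
  qed (use x y L in auto)
qed

text \<open>The intersection of \<open>A\<close> and \<open>B\<close> is the point of
  \<open>S'\<close> on \<open>L\<close> and also the one on \<open>M\<close>; so the lines meet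
  there, and \<open>ros_mono\<close> applies both ways.\<close>

lemma ros_common:
  assumes L: "L \<in> lines S" "M \<in> lines S"
    and A: "A \<in> ros L" "A \<in> ros M" and B: "B \<in> ros L" "B \<in> ros M" and AB: "A \<noteq> B"
  shows "\<exists>z\<in>points S'. inc S z L \<and> inc S z M" and "ros L = ros M"
proof -
  obtain x y where x: "x \<in> Ext" "inc S x L" "A = \<O> x" and y: "y \<in> Ext" "inc S y L" "B = \<O> y"
    using A B by blast
  obtain x' y' where x': "x' \<in> Ext" "inc S x' M" "A = \<O> x'" and y': "y' \<in> Ext" "inc S y' M" "B = \<O> y'"
    using A B by blast
  obtain z where z: "z \<in> points S'" "inc S z L"
    using tangent_exists x L by metis
  obtain z' where z': "z' \<in> points S'" "inc S z' M"
    using tangent_exists x' L by metis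
  have "A \<inter> B = {z}" "A \<inter> B = {z'}"
    using Ov_Int_collinear[of x y L z] Ov_Int_collinear[of x' y' M z'] x y x' y' z z' L AB by auto
  then have "z = z'"
    by simp
  then show "\<exists>z\<in>points S'. inc S z L \<and> inc S z M" "ros L = ros M"
    using ros_mono[of x x' L M z] ros_mono[of x' x M L z] x x' L z z' by auto
qed

section \<open>The geometry of subtended ovoids and rosettes\<close>

abbreviation E :: "('p set, 'p set set) geometry" where "E \<equiv> ovoid_rosette_geometry S S'"

lemma points_E: "points E = \<O> ` Ext"
  and lines_E: "lines E = ros ` (lines S - lines S')"
  and inc_E: "inc E = (\<in>)"
  by (simp_all add: ovoid_rosette_geometry_def subtended_ovoids_def rosettes_eq)

text \<open>Ovoids on a common rosette come from collinear points that may be other twins than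
  \<open>x\<close> and \<open>y\<close>; the criterion by intersection size carries the relation
  back to \<open>x\<close> and \<open>y\<close>.\<close>

lemma collinear_E_iff:
  assumes x: "x \<in> Ext" and y: "y \<in> Ext"
  shows "collinear E (\<O> x) (\<O> y) \<longleftrightarrow> \<O> x = \<O> y \<or> y \<in> tied x"
proof -
  have "y \<in> tied x" if ne: "\<O> x \<noteq> \<O> y" and L: "L \<in> lines S - lines S'" "\<O> x \<in> ros L" "\<O> y \<in> ros L" for L
  proof -
    obtain x1 y1 where *: "x1 \<in> Ext" "inc S x1 L" "\<O> x = \<O> x1" "y1 \<in> Ext" "inc S y1 L" "\<O> y = \<O> y1"
      using L by blast
    then have "card (\<O> x1 \<inter> \<O> y1) = 1"
      using L ne by (intro card_Ov_Int_collinear) (auto intro: collinearI)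
    then show ?thesis
      using tied_iff x y * by simp
  qed
  moreover have "\<exists>L\<in>lines S - lines S'. \<O> x \<in> ros L \<and> \<O> y \<in> ros L" if "y \<in> tied x"
  proof -
    from that obtain x' where *: "x' \<in> Ext" "\<O> x' = \<O> x" "collinear S x' y" "x' \<noteq> y"
      by (auto simp: tied_def)
    then obtain L where L: "L \<in> lines S" "inc S x' L" "inc S y L"
      using collinearE by metis
    then have "L \<in> lines S - lines S'"
      using ext_line_iff[of y L] y by blast
    moreover have "\<O> x \<in> ros L"
      using * L by (metis (mono_tags, lifting) imageI mem_Collect_eq)
    ultimately show ?thesis
      using L y by blast
  qed
  ultimately show ?thesis
    unfolding collinear_def lines_E inc_E by blast
qed

lemma t'_less_t: "t' < t"
  using t_eq s_ge_2 t'_ge_1 by simp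

lemma ext_nonempty: "Ext \<noteq> {}"
proof
  assume "Ext = {}"
  then have "card Ext = 0"
    by (simp only: card.empty)
  then show False
    using s_ge_2 t'_less_t unfolding card_ext by simp
qed

text \<open>Every rosette on \<open>\<O> x\<close> comes from a line through \<open>x\<close>
  itself: if \<open>M\<close> passes through a twin of \<open>x\<close> and meets \<open>S'\<close>
  in \<open>z\<close>, then \<open>z\<close> is in \<open>\<O> x\<close>, and the line joining
  \<open>x\<close> and \<open>z\<close> has the same rosette.\<close>

lemma card_pencil_E:
  assumes x: "x \<in> Ext"
  shows "card {R \<in> lines E. \<O> x \<in> R} = t + 1"
proof -
  let ?P = "{L \<in> lines S. inc S x L}"
  have "{R \<in> lines E. \<O> x \<in> R} = ros ` ?P"
  proof (intro equalityI subsetI)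
    fix R assume "R \<in> {R \<in> lines E. \<O> x \<in> R}"
    then obtain M x' where M: "M \<in> lines S - lines S'" "R = ros M" "x' \<in> Ext" "\<O> x = \<O> x'" "inc S x' M"
      unfolding lines_E by blast
    obtain z where z: "z \<in> points S'" "inc S z M"
      using tangent_exists M by blast
    have "z \<in> \<O> x"
      unfolding M(4) using M z by (auto simp: mem_Ov intro: collinearI)
    then obtain L where L: "L \<in> lines S" "inc S x L" "inc S z L"
      using x mem_Ov collinearE by (metis DiffE)
    then have "R = ros L"
      using ros_mono[of x x' L M z] ros_mono[of x' x M L z] M x z by (intro equalityI) auto
    then show "R \<in> ros ` ?P"
      using L by blast
  next
    fix R assume "R \<in> ros ` ?P"
    then show "R \<in> {R \<in> lines E. \<O> x \<in> R}"
      using x ext_line_iff unfolding lines_E by blast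
  qed
  moreover have "inj_on ros ?P"
  proof
    fix L M assume LM: "L \<in> ?P" "M \<in> ?P" "ros L = ros M"
    then have L: "L \<in> lines S - lines S'"
      using x ext_line_iff by blast
    \<comment> \<open>Two ovoids in the common rosette force a common point of \<open>L\<close> and
      \<open>M\<close> in \<open>S'\<close>; being different from \<open>x\<close>, it determines
      the line.\<close>
    have "\<not> card (ros L) \<le> Suc 0"
      using card_ros[OF L] s_ge_2 by simp
    then obtain A B where AB: "A \<in> ros L" "B \<in> ros L" "A \<noteq> B"
      using card_le_Suc0_iff_eq[of "ros L"] by auto
    moreover from AB LM have "A \<in> ros M" "B \<in> ros M"
      by simp_all
    ultimately have "\<exists>z\<in>points S'. inc S z L \<and> inc S z M"
      using LM by (intro ros_common(1)[of L M A B]) simp_all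
    then obtain z where "z \<in> points S'" "inc S z L" "inc S z M"
      by blast
    then show "L = M"
      using line_unique[of x z L M] x LM(1,2) points_sub by blast
  qed
  ultimately show ?thesis
    using card_image[of ros ?P] card_pencil x by simp
qed

lemma partial_linear_space_E: "partial_linear_space E (s - 1) t"
proof -
  obtain x where x: "x \<in> Ext"
    using ext_nonempty by blast
  have "points E \<noteq> {}"
    using x points_E by blast
  moreover have "lines E \<noteq> {}"
    using card_pencil_E[OF x] by (metis (no_types, lifting) Collect_empty_eq card.empty add_is_0 empty_iff one_neq_zero)
  moreover have "card {A \<in> points E. A \<in> R} = s - 1 + 1" if "R \<in> lines E" for R
  proof -
    have "{A \<in> points E. A \<in> R} = R"
      using that unfolding points_E lines_E by blast
    then show ?thesis
      using that card_ros s_ge_2 unfolding lines_E by auto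
  qed
  moreover have "card {R \<in> lines E. A \<in> R} = t + 1" if "A \<in> points E" for A
    using that card_pencil_E unfolding points_E by blast
  moreover have "Q = R" if QR: "A \<noteq> B" "Q \<in> lines E" "R \<in> lines E" "A \<in> Q" "A \<in> R" "B \<in> Q" "B \<in> R" for A B Q R
  proof -
    obtain L M where "L \<in> lines S" "M \<in> lines S" "Q = ros L" "R = ros M"
      using QR unfolding lines_E by blast
    then show ?thesis
      using QR ros_common(2)[of L M A B] by simp
  qed
  ultimately show ?thesis
    unfolding partial_linear_space_def inc_E by (intro conjI ballI impI) blast+
qed

text \<open>Let \<open>z\<close> be the point of \<open>S'\<close> on \<open>L\<close>. If
  \<open>\<O> x\<close> contains \<open>z\<close>, the twins of \<open>x\<close> see no other point
  of \<open>L\<close> and the count is \<open>0\<close>. Otherwise each of the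
  \<open>\<theta>\<close> twins sees its own external point of \<open>L\<close>.\<close>

lemma card_collinear_on_ros:
  assumes x: "x \<in> Ext" and L: "L \<in> lines S - lines S'" and xL: "\<O> x \<notin> ros L"
  shows "card {B \<in> points E. B \<in> ros L \<and> collinear E (\<O> x) B} \<in> {0, \<theta>}"
proof -
  let ?Y = "{y \<in> Ext. inc S y L \<and> y \<in> tied x}"
  have nL: "\<not> inc S x' L" if "x' \<in> twins x" for x'
  proof
    assume "inc S x' L"
    then have "\<O> x' \<in> ros L"
      using that by blast
    then show False
      using that xL by simp
  qed
  have "{B \<in> points E. B \<in> ros L \<and> collinear E (\<O> x) B} = \<O> ` ?Y"
  proof (intro equalityI subsetI)
    fix B assume "B \<in> {B \<in> points E. B \<in> ros L \<and> collinear E (\<O> x) B}"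
    then show "B \<in> \<O> ` ?Y"
      using xL collinear_E_iff[OF x] by force
  next
    fix B assume "B \<in> \<O> ` ?Y"
    then show "B \<in> {B \<in> points E. B \<in> ros L \<and> collinear E (\<O> x) B}"
      using collinear_E_iff[OF x] unfolding points_E by blast
  qed
  moreover have "inj_on \<O> ?Y"
    using L by (intro inj_on_subset[OF inj_on_Ov_line[of L]]) auto
  ultimately have card: "card {B \<in> points E. B \<in> ros L \<and> collinear E (\<O> x) B} = card ?Y"
    by (simp only: card_image)
  obtain z where z: "z \<in> points S'" "inc S z L" "{y \<in> Ext. inc S y L} = {y \<in> points S. inc S y L} - {z}"
    using ext_line L by blast
  show ?thesis
  proof (cases "z \<in> \<O> x")
    case True
    have "False" if "y \<in> ?Y" for y
    proof -
      obtain x' where x': "x' \<in> twins x" "collinear S x' y"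
        using \<open>y \<in> ?Y\<close> by (auto simp: tied_def)
      then have "z \<in> \<O> x'"
        using True by simp
      then have "collinear S x' z"
        by (simp add: mem_Ov)
      then have "inc S x' L"
        using no_triangle[of L y z x'] that x' z points_sub L by blast
      then show False
        using nL x' by blast
    qed
    then have "?Y = {}"
      by blast
    then have "card ?Y = 0"
      by (simp only: card.empty)
    then show ?thesis
      using card by simp
  next
    case False
    \<comment> \<open>A twin is off \<open>L\<close> and does not see \<open>z\<close>, so its
      unique projection onto \<open>L\<close> is in \<open>?Y\<close>; conversely each point of
      \<open>?Y\<close> sees exactly one twin.\<close>
    have "card (twins x) * 1 = card ?Y * 1"
    proof (rule sum_multicount_eq[where R = "collinear S"])
      fix x' assume x': "x' \<in> twins x"
      have "{y \<in> ?Y. collinear S x' y} = {y \<in> points S. inc S y L \<and> collinear S x' y}"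
      proof (intro equalityI subsetI)
        fix y assume y: "y \<in> {y \<in> points S. inc S y L \<and> collinear S x' y}"
        have "z \<notin> \<O> x'"
          using False x' by simp
        then have "y \<noteq> z"
          using y z by (auto simp: mem_Ov)
        then have y': "y \<in> Ext"
          using y z by blast
        then have "\<O> y \<in> ros L"
          using y by blast
        then have "\<O> y \<noteq> \<O> x"
          using xL by metis
        then show "y \<in> {y \<in> ?Y. collinear S x' y}"
          using y y' x' unfolding tied_def by blast
      qed auto
      then show "card {y \<in> ?Y. collinear S x' y} = 1"
        using card_line_projection[of x' L] x' L nL[OF x'] by simp
    qed (auto intro: card_collinear_twins[simplified])
    then show ?thesis
      using card card_twins[OF x] by simp
  qed
qed

text \<open>Each common neighbour is subtended by exactly one point collinear with \<open>x\<close>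
  itself; these points form \<open>?W\<close>. They are counted over the \<open>\<theta>\<close>
  twins \<open>y'\<close> of \<open>y\<close>: of the \<open>t + 1\<close> points in the trace of
  \<open>x\<close> and \<open>y'\<close>, exactly \<open>t' + 1\<close> lie in
  \<open>S'\<close>.\<close>

lemma card_common_E:
  assumes x: "x \<in> Ext" and y: "y \<in> Ext" and xy: "\<not> collinear E (\<O> x) (\<O> y)"
  shows "card (perp E (\<O> x) \<inter> perp E (\<O> y)) = \<theta> * (t - t')"
proof -
  let ?W = "{w \<in> Ext. collinear S x w \<and> w \<noteq> x \<and> w \<in> tied y}"
  have ne: "\<O> x \<noteq> \<O> y" and nt: "y \<notin> tied x" "x \<notin> tied y"
    using xy collinear_E_iff[OF x y] tied_commute[OF x y] by auto
  have "perp E (\<O> x) \<inter> perp E (\<O> y) = \<O> ` ?W"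
  proof (intro equalityI subsetI)
    fix C assume "C \<in> perp E (\<O> x) \<inter> perp E (\<O> y)"
    then obtain w where w: "w \<in> Ext" "C = \<O> w" "collinear E (\<O> x) (\<O> w)" "collinear E (\<O> y) (\<O> w)"
      unfolding perp_def points_E by blast
    moreover have "\<O> w \<noteq> \<O> x" "\<O> w \<noteq> \<O> y"
      using w xy by (auto simp: collinear_commute)
    ultimately have "w \<in> tied x" and wy: "w \<in> tied y"
      using collinear_E_iff x y by auto
    \<comment> \<open>Symmetry moves the choice of a twin from \<open>x\<close> to \<open>w\<close>,
      so \<open>x\<close> stays fixed.\<close>
    then have "x \<in> tied w"
      using tied_commute x w by blast
    then obtain w' where w': "w' \<in> Ext" "\<O> w' = \<O> w" "collinear S w' x"
      by (auto simp: tied_def)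
    moreover have "w' \<in> tied y"
      using wy w w' y tied_iff by metis
    moreover have "w' \<noteq> x"
      using w' \<open>\<O> w \<noteq> \<O> x\<close> by auto
    ultimately have "w' \<in> ?W"
      by (simp add: collinear_commute)
    then show "C \<in> \<O> ` ?W"
      using w w' by blast
  next
    fix C assume "C \<in> \<O> ` ?W"
    then obtain w where w: "w \<in> Ext" "collinear S x w" "w \<noteq> x" "w \<in> tied y" "C = \<O> w"
      by blast
    moreover have "w \<in> tied x"
      using w x tied_iff card_Ov_Int_collinear by metis
    ultimately show "C \<in> perp E (\<O> x) \<inter> perp E (\<O> y)"
      unfolding perp_def points_E using collinear_E_iff x y by blast
  qed
  moreover have "inj_on \<O> ?W"
    by (rule inj_onI) (use collinear_twin_unique x in \<open>auto simp: collinear_commute\<close>)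
  moreover have "card ?W * 1 = card (twins y) * (t - t')"
  proof (rule sum_multicount_eq[where R = "\<lambda>w y'. collinear S y' w"])
    fix y' assume y': "y' \<in> twins y"
    have nxy: "\<not> collinear S x y'"
    proof
      assume "collinear S x y'"
      then have "collinear S y' x"
        by (simp only: collinear_commute)
      then have "x \<in> tied y"
        using x y' ne unfolding tied_def by blast
      then show False
        using nt by blast
    qed
    \<comment> \<open>An external point of the trace is tied to \<open>y\<close>, because as a
      neighbour of \<open>y'\<close> it cannot be a twin of \<open>y'\<close>.\<close>
    have "{w \<in> ?W. collinear S y' w} = (perp S x \<inter> perp S y') - (\<O> x \<inter> \<O> y')"
    proof (intro equalityI subsetI)
      fix w assume "w \<in> {w \<in> ?W. collinear S y' w}"
      then show "w \<in> (perp S x \<inter> perp S y') - (\<O> x \<inter> \<O> y')"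
        by (auto simp: perp_def mem_Ov)
    next
      fix w assume "w \<in> (perp S x \<inter> perp S y') - (\<O> x \<inter> \<O> y')"
      then have w: "w \<in> Ext" "collinear S x w" "collinear S y' w"
        by (auto simp: perp_def mem_Ov)
      moreover have "w \<noteq> x" "w \<noteq> y'"
        using w nxy by (auto simp: collinear_commute)
      moreover have "\<O> w \<noteq> \<O> y"
      proof
        assume "\<O> w = \<O> y"
        then have "\<O> y' = \<O> w"
          using y' by simp
        then show False
          using twins_not_collinear[of y' w] y' w \<open>w \<noteq> y'\<close> by blast
      qed
      ultimately show "w \<in> {w \<in> ?W. collinear S y' w}"
        using y' unfolding tied_def by blast
    qed
    moreover have "card (\<O> x \<inter> \<O> y') = t' + 1"
      using card_Ov_Int_not_tied[OF x y ne[symmetric] nt(1)] y' by simp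
    moreover have "card (perp S x \<inter> perp S y') = t + 1"
      using card_trace nxy x y' by blast
    moreover have "\<O> x \<inter> \<O> y' \<subseteq> perp S x \<inter> perp S y'"
      by (auto simp: subtended_def)
    ultimately show "card {w \<in> ?W. collinear S y' w} = t - t'"
      by (simp add: card_Diff_subset)
  qed (auto intro: card_collinear_twins[simplified])
  ultimately show ?thesis
    by (simp only: card_image card_twins[OF y] mult_1_right)
qed

theorem semipartial_geometry_E: "semipartial_geometry E (s - 1) t \<theta> (\<theta> * (t - t'))"
  unfolding semipartial_geometry_def
proof (intro conjI ballI impI)
  show "partial_linear_space E (s - 1) t"
    by (rule partial_linear_space_E)
  show "0 < \<theta>" "0 < \<theta> * (t - t')"
    using \<theta>_gt_1 t'_less_t by auto
next
  fix A R assume A: "A \<in> points E" "R \<in> lines E" "\<not> inc E A R"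
  obtain x where "x \<in> Ext" "A = \<O> x"
    using A(1) unfolding points_E by blast
  moreover obtain L where "L \<in> lines S - lines S'" "R = ros L"
    using A(2) unfolding lines_E by blast
  ultimately show "card {B \<in> points E. inc E B R \<and> collinear E A B} \<in> {0, \<theta>}"
    using A(3) card_collinear_on_ros[of x L] by (simp only: inc_E not_False_eq_True simp_thms)
next
  fix A B assume A: "A \<in> points E" "B \<in> points E" "\<not> collinear E A B"
  obtain x y where "x \<in> Ext" "A = \<O> x" "y \<in> Ext" "B = \<O> y"
    using A(1,2) unfolding points_E by blast
  then show "card (perp E A \<inter> perp E B) = \<theta> * (t - t')"
    using A(3) card_common_E[of x y] by (simp only: simp_thms)
qed

end

theorem theorem8p1:
  fixes S S' :: "('p, 'l) geometry" and s t t' \<theta> :: nat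
  assumes "finite_geometry S"
    and "generalized_quadrangle S s t"
    and "proper_subquadrangle S' S s t'"
    and "s \<noteq> 1"
    and "\<forall>x \<in> points S - points S'. theta_subtended S S' \<theta> (subtended S S' x)"
    and "\<theta> > 1"
    and "t' \<noteq> 1"
    and "t = s * t'"
    and "(\<theta> - 1) * t = s ^ 2"
  shows "semipartial_geometry (ovoid_rosette_geometry S S') (s - 1) t \<theta> (\<theta> * (t - t'))"
proof -
  have S': "subgeometry S' S" "generalized_quadrangle S' s t'" "points S' \<noteq> points S \<or> lines S' \<noteq> lines S"
    using assms(3) by (auto simp: proper_subquadrangle_def)
  have fin: "finite_geometry S'"
    using assms(1) S'(1) by (auto simp: finite_geometry_def subgeometry_def intro: finite_subset)
  interpret S: gq S s t
    using assms by unfold_locales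
  interpret S': gq S' s t'
    using fin S' by unfold_locales
  \<comment> \<open>If \<open>s = 0\<close>, then \<open>t = 0\<close> and both quadrangles consist
    of one point and one line, so \<open>S'\<close> would not be proper.\<close>
  have "s \<noteq> 0"
  proof
    assume s: "s = 0"
    then have t: "t = 0"
      using assms by simp
    have "card (points S') = 1" "card (points S) = 1"
      using S.card_points S'.card_points s t by simp_all
    then have points: "points S' = points S"
      using S'(1) by (intro card_subset_eq) (auto simp: subgeometry_def)
    obtain x where x: "points S = {x}"
      using \<open>card (points S) = 1\<close> card_1_singletonE by blast
    have on_x: "inc S x L" if "L \<in> lines S" for L
      using S.card_line[OF that] x s by (metis (mono_tags, lifting) Collect_empty_eq add_0 card.empty singletonD zero_neq_one)
    then have "{L \<in> lines S. inc S x L} = lines S"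
      by blast
    then have "card (lines S) = 1"
      using S.card_pencil[of x] x t by simp
    moreover have "card (lines S') > 0"
      using S'.lines_nonempty by (simp add: card_gt_0_iff)
    ultimately have "lines S' = lines S"
      using S'(1) by (intro card_seteq) (auto simp: subgeometry_def)
    then show False
      using points S'(3) by simp
  qed
  \<comment> \<open>Substituting \<open>t = s * t'\<close> into
    \<open>(\<theta> - 1) * t = s ^ 2\<close> allows cancelling one nonzero factor \<open>s\<close>;
    the result also shows that \<open>t'\<close> is positive.\<close>
  moreover have "(\<theta> - 1) * t' = s"
  proof -
    have "s * ((\<theta> - 1) * t') = s * s"
      using assms(8,9) by (simp add: power2_eq_square algebra_simps)
    then show ?thesis
      using \<open>s \<noteq> 0\<close> by simp
  qed
  ultimately interpret subq S S' s t t' \<theta>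
    using assms by unfold_locales (auto intro: ccontr)
  show ?thesis
    by (rule semipartial_geometry_E)
qed

end
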